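(* Let $n\geqslant 2$, and let $C^+$ be the best (largest) constant such that $$\int_{\mathbb{R}^n_+}\int_{\partial\mathbb{R}^n_+} f(x)\,|x-y|^2\, g(y)\,dx\,dy\ \geqslant\ C^+\Big(\int_{\partial\mathbb{R}^n_+}|f|^{p}\,dx\Big)^{1/p}\Big(\int_{\mathbb{R}^n_+}|g|^{r}\,dy\Big)^{1/r},\qquad p=\frac{n-1}{n},\quad r=\frac{n}{n+1},$$ holds for all nonnegative functions $f\in L^{p}(\partial\mathbb{R}^n_+)$ and $g\in L^{r}(\mathbb{R}^n_+)$. Then $$C^+=\frac{2^{-1+1/n}}{\pi}\left(\frac{\Gamma(n)}{\Gamma(n/2)}\right)^{1/n}\left(\frac{\Gamma(n-1)}{\Gamma((n-1)/2)}\right)^{1/(n-1)}.$$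
   Context: $\mathbb{R}^n_+=\{y=(y',y_n)\in\mathbb{R}^n: y'\in\mathbb{R}^{n-1},\ y_n>0\}$, and its boundary $\partial\mathbb{R}^n_+$ is identified with $\mathbb{R}^{n-1}$ (with $(n-1)$-dimensional Lebesgue measure); for $x\in\partial\mathbb{R}^n_+$ and $y=(y',y_n)\in\mathbb{R}^n_+$, $|x-y|=\sqrt{|y'-x|^2+y_n^2}$. For $0<\vartheta<1$, $\phi\in L^\vartheta(\Omega)$ means that $\phi$ is measurable with $\int_\Omega|\phi|^\vartheta<+\infty$. $\Gamma$ is the Gamma function. *)

theory Defs
  imports "HOL-Analysis.Analysis"
begin

text \<open>
  \<open>\<real>\<^sup>n\<close> is modelled as \<open>(real ^ 'm) \<times> real\<close> with \<open>CARD('m) = n - 1\<close>: a point is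
  \<open>y = (y', y\<^sub>n)\<close>, and the library norm on the product is the Euclidean one. The boundary of the
  half space is identified with \<open>real ^ 'm\<close> through \<open>x \<mapsto> (x, 0)\<close>, so that \<open>|x - y|\<close> is
  \<open>dist (x, 0) y\<close>.
\<close>

definition half_space :: "((real ^ 'm::finite) \<times> real) set" where
  "half_space = {y. snd y > 0}"

text \<open>
  Intended for \<open>0 < \<theta> < 1\<close>, where \<open>Lquasinorm\<close> is only a quasi-norm. Since
  \<open>0 powr \<theta> = 0\<close>, zeros of the function contribute nothing.
\<close>

definition Lspace :: "real \<Rightarrow> 'a::euclidean_space set \<Rightarrow> ('a \<Rightarrow> real) set" where
  "Lspace \<theta> \<Omega> = {\<phi>. \<phi> \<in> borel_measurable (lebesgue_on \<Omega>) \<and>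
     (\<integral>\<^sup>+x. ennreal (\<bar>\<phi> x\<bar> powr \<theta>) \<partial>lebesgue_on \<Omega>) < \<infinity>}"

definition Lquasinorm :: "real \<Rightarrow> 'a::euclidean_space set \<Rightarrow> ('a \<Rightarrow> real) \<Rightarrow> real" where
  "Lquasinorm \<theta> \<Omega> \<phi> = (LINT x|lebesgue_on \<Omega>. \<bar>\<phi> x\<bar> powr \<theta>) powr (1 / \<theta>)"

text \<open>The double integral of a nonnegative integrand may be infinite, hence the values in
  \<open>ennreal\<close>.\<close>

definition interaction ::
    "(real ^ 'm::finite \<Rightarrow> real) \<Rightarrow> ((real ^ 'm) \<times> real \<Rightarrow> real) \<Rightarrow> ennreal" where
  "interaction f g =
     (\<integral>\<^sup>+y. (\<integral>\<^sup>+x. ennreal (f x * (dist (x, 0) y)\<^sup>2 * g y) \<partial>lebesgue) \<partial>lebesgue_on half_space)"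

text \<open>Negative \<open>C\<close> are admissible trivially (\<open>ennreal\<close> truncates them to 0), which does not affect
  the largest admissible constant.\<close>

definition admissible_constant :: "'m::finite itself \<Rightarrow> real \<Rightarrow> real \<Rightarrow> real \<Rightarrow> bool" where
  "admissible_constant _ p r C \<longleftrightarrow>
     (\<forall>(f :: real ^ 'm \<Rightarrow> real) (g :: (real ^ 'm) \<times> real \<Rightarrow> real).
        f \<in> Lspace p UNIV \<longrightarrow> (\<forall>x. 0 \<le> f x) \<longrightarrow>
        g \<in> Lspace r half_space \<longrightarrow> (\<forall>y\<in>half_space. 0 \<le> g y) \<longrightarrow>
        interaction f g \<ge> ennreal (C * Lquasinorm p UNIV f * Lquasinorm r half_space g))"

definition best_constant :: "'m::finite itself \<Rightarrow> real \<Rightarrow> real \<Rightarrow> real \<Rightarrow> bool" where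
  "best_constant T p r C \<longleftrightarrow>
     admissible_constant T p r C \<and> (\<forall>C'. admissible_constant T p r C' \<longrightarrow> C' \<le> C)"

end

theory Submission
  imports Defs "HOL-Probability.Distributions"
begin

text \<open>
  Since \<open>|x - y|\<^sup>2\<close> is a polynomial, \<open>h(y) = \<integral> f(x) |x - y|\<^sup>2 dx\<close> is explicit: if it is finite
  somewhere, then \<open>h(y) = V + F |y - (a, 0)|\<^sup>2\<close> with \<open>F\<close> the mass, \<open>a\<close> the barycenter and \<open>V\<close>
  the centered second moment of \<open>f\<close>. In dimension \<open>d\<close>, with exponent \<open>d / (d + 1)\<close>, reverse Hoelder
  against the weight \<open>|x - t|\<^sup>2 + s\<^sup>2\<close> and scaling give
  \<open>\<integral> u(x) (|x - t|\<^sup>2 + s\<^sup>2) dx \<ge> s \<parallel>u\<parallel> J\<^bsup>-1/d\<^esup>\<close> with \<open>J = \<integral> (1 + |x|\<^sup>2)\<^bsup>-d\<^esup> dx\<close>. Applied to \<open>f\<close>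
  around \<open>a\<close> for all \<open>s > 0\<close>, this bounds \<open>2 (F V)\<^bsup>1/2\<^esup>\<close> from below; applied to \<open>g\<close> with
  \<open>s\<^sup>2 = V / F\<close>, it bounds \<open>\<integral> h g\<close> by \<open>(F V)\<^bsup>1/2\<^esup>\<close> times the quasi-norm of \<open>g\<close>. Both steps are
  equalities for \<open>f = (1 + |x|\<^sup>2)\<^bsup>-n\<^esup>\<close> and \<open>g = (1 + |y|\<^sup>2)\<^bsup>-(n+1)\<^esup>\<close>.
\<close>

section \<open>The weight \<open>(1 + |x|\<^sup>2)\<^bsup>-d\<^esup>\<close>\<close>

text \<open>The Gaussian is a product over the coordinates, so Tonelli leaves a power of the
  one-dimensional integral, which is known from the total mass 1 of the normal distribution.\<close>

lemma nn_integral_gaussian_euclidean: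
  assumes t: "t > 0"
  shows "(\<integral>\<^sup>+x. ennreal (exp (- t * (norm x)\<^sup>2)) \<partial>(lborel :: 'a::euclidean_space measure))
           = ennreal ((pi / t) powr (DIM('a) / 2))"
proof -
  have g1: "(\<integral>\<^sup>+x. ennreal (exp (- t * x\<^sup>2)) \<partial>lborel) = ennreal (sqrt (pi / t))"
  proof -
    \<comment> \<open>The variance for which \<open>x\<^sup>2 / (2 * \<sigma>\<^sup>2)\<close> is
      the exponent \<open>t * x\<^sup>2\<close>.\<close>
    define \<sigma> where "\<sigma> = sqrt (1 / (2 * t))"
    have \<sigma>: "\<sigma> > 0" "\<sigma>\<^sup>2 = 1 / (2 * t)" using t by (auto simp: \<sigma>_def)
    interpret prob_space "density lborel (normal_density 0 \<sigma>)"
      by (rule prob_space_normal_density[OF \<sigma>(1)])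
    have 1: "(\<integral>\<^sup>+x. ennreal (normal_density 0 \<sigma> x) \<partial>lborel) = 1"
      using emeasure_space_1 by (simp add: emeasure_density)
    have "2 * pi * \<sigma>\<^sup>2 = pi / t" "x\<^sup>2 / (2 * \<sigma>\<^sup>2) = t * x\<^sup>2" for x :: real
      using t by (simp_all add: \<sigma>(2))
    then have 2: "exp (- t * x\<^sup>2) = sqrt (pi / t) * normal_density 0 \<sigma> x" for x
      using t by (simp add: normal_density_def)
    show ?thesis
      using t unfolding 2 by (simp add: ennreal_mult' nn_integral_cmult 1)
  qed
  have "(norm x)\<^sup>2 = (\<Sum>b\<in>Basis. (x \<bullet> b)\<^sup>2)" for x :: 'a
    unfolding power2_norm_eq_inner by (subst euclidean_inner) (simp add: power2_eq_square)
  then have "exp (- t * (norm x)\<^sup>2) = (\<Prod>b\<in>Basis. exp (- t * (x \<bullet> b)\<^sup>2))" for x :: 'a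
    by (simp add: exp_sum[symmetric] sum_negf sum_distrib_left[symmetric])
  then have "(\<integral>\<^sup>+x. ennreal (exp (- t * (norm x)\<^sup>2)) \<partial>(lborel :: 'a measure))
      = (\<integral>\<^sup>+x. (\<Prod>b\<in>Basis. ennreal (exp (- t * (x \<bullet> b)\<^sup>2))) \<partial>(lborel :: 'a measure))"
    by (simp add: prod_ennreal)
  also have "\<dots> = (\<Prod>b\<in>(Basis::'a set). \<integral>\<^sup>+x. ennreal (exp (- t * x\<^sup>2)) \<partial>lborel)"
    by (rule nn_integral_lborel_prod) auto
  also have "\<dots> = ennreal (sqrt (pi / t) ^ DIM('a))"
    using t unfolding g1 by (simp add: ennreal_power)
  also have "sqrt (pi / t) ^ DIM('a) = (pi / t) powr (DIM('a) / 2)"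
    using t by (simp add: powr_half_sqrt[symmetric] powr_realpow[symmetric] powr_powr)
  finally show ?thesis .
qed

text \<open>Substituting a t for t in Euler's integral. It serves to write the inverse power of a as
  a superposition of exponentials in a.\<close>

lemma nn_integral_exp_Gamma:
  assumes "a > 0" "s > (0::real)"
  shows "(\<integral>\<^sup>+t. ennreal (t powr (s - 1) * exp (- a * t)) * indicator {0<..} t \<partial>lborel)
           = ennreal (Gamma s / a powr s)"
proof -
  have "Gamma s = (\<integral>\<^sup>+t. ennreal (indicator {0..} t * t powr (s - 1) / exp t) \<partial>lborel)"
    by (rule Gamma_conv_nn_integral_real[OF assms(2)])
  also have "\<dots> = ennreal a * (\<integral>\<^sup>+t. ennreal (indicator {0..} (a * t) * (a * t) powr (s - 1) / exp (a * t)) \<partial>lborel)"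
    using assms(1) by (subst nn_integral_real_affine[where c = a and t = 0]) auto
  also have "\<dots> = (\<integral>\<^sup>+t. ennreal a * ennreal (indicator {0..} (a * t) * (a * t) powr (s - 1) / exp (a * t)) \<partial>lborel)"
    by (rule nn_integral_cmult[symmetric]) auto
  also have "\<dots> = (\<integral>\<^sup>+t. ennreal (a powr s) * (ennreal (t powr (s - 1) * exp (- a * t)) * indicator {0<..} t) \<partial>lborel)"
  proof (rule nn_integral_cong)
    fix t :: real
    show "ennreal a * ennreal (indicator {0..} (a * t) * (a * t) powr (s - 1) / exp (a * t))
       = ennreal (a powr s) * (ennreal (t powr (s - 1) * exp (- a * t)) * indicator {0<..} t)"
      using assms powr_add[of a "s - 1" 1]
      by (cases "t > 0"; cases "t = 0")
         (auto simp: ennreal_mult'[symmetric] indicator_def zero_le_mult_iff powr_mult exp_minus divide_inverse algebra_simps)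
  qed
  also have "\<dots> = ennreal (a powr s) * (\<integral>\<^sup>+t. ennreal (t powr (s - 1) * exp (- a * t)) * indicator {0<..} t \<partial>lborel)"
    by (rule nn_integral_cmult) auto
  finally have *: "ennreal (Gamma s) = ennreal (a powr s) * (\<integral>\<^sup>+t. ennreal (t powr (s - 1) * exp (- a * t)) * indicator {0<..} t \<partial>lborel)" .
  have "ennreal (Gamma s / a powr s) = ennreal (1 / a powr s) * ennreal (Gamma s)"
    using assms by (simp add: ennreal_mult'[symmetric] Gamma_real_pos less_imp_le)
  also have "\<dots> = (ennreal (1 / a powr s) * ennreal (a powr s)) * (\<integral>\<^sup>+t. ennreal (t powr (s - 1) * exp (- a * t)) * indicator {0<..} t \<partial>lborel)"
    unfolding * by (simp add: mult.assoc)
  also have "ennreal (1 / a powr s) * ennreal (a powr s) = 1"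
    using assms by (simp add: ennreal_mult'[symmetric])
  finally show ?thesis by simp
qed

text \<open>With d the dimension, Gamma(d) times the weight is the integral over t > 0 of t^(d-1)
  exp(-(1+|x|^2) t). After exchanging integrals the Gaussian in x contributes (pi/t)^(d/2), which
  lowers the exponent d-1 to d/2-1 and leaves Gamma(d/2).\<close>

lemma nn_integral_conformal_weight:
  "(\<integral>\<^sup>+x. ennreal (1 / (1 + (norm x)\<^sup>2) ^ DIM('a)) \<partial>(lborel :: 'a::euclidean_space measure))
     = ennreal (pi powr (DIM('a) / 2) * Gamma (DIM('a) / 2) / Gamma (DIM('a)))"
proof -
  define d where "d = real DIM('a)"
  have d: "d > 0" by (simp add: d_def)
  let ?M = "lborel :: 'a measure"
  let ?K = "\<lambda>x t. ennreal (t powr (d - 1) * exp (- (1 + (norm x)\<^sup>2) * t)) * indicator {0<..} (t::real)"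
  have pos: "1 + (norm x)\<^sup>2 > 0" for x :: 'a by (simp add: add_pos_nonneg)
  have "ennreal (Gamma d) * (\<integral>\<^sup>+x. ennreal (1 / (1 + (norm x)\<^sup>2) ^ DIM('a)) \<partial>?M)
     = (\<integral>\<^sup>+x. ennreal (Gamma d) * ennreal (1 / (1 + (norm x)\<^sup>2) ^ DIM('a)) \<partial>?M)"
    by (rule nn_integral_cmult[symmetric]) auto
  also have "\<dots> = (\<integral>\<^sup>+x. (\<integral>\<^sup>+t. ?K x t \<partial>lborel) \<partial>?M)"
  proof (rule nn_integral_cong)
    fix x :: 'a
    show "ennreal (Gamma d) * ennreal (1 / (1 + (norm x)\<^sup>2) ^ DIM('a)) = (\<integral>\<^sup>+t. ?K x t \<partial>lborel)"
      using d pos[of x] by (simp only: nn_integral_exp_Gamma)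
        (simp add: ennreal_mult'[symmetric] d_def powr_realpow)
  qed
  also have "\<dots> = (\<integral>\<^sup>+t. (\<integral>\<^sup>+x. ?K x t \<partial>?M) \<partial>lborel)"
    by (rule lborel_pair.Fubini'[symmetric]) (simp add: case_prod_unfold, measurable)
  also have "\<dots> = (\<integral>\<^sup>+t. ennreal (pi powr (d / 2)) * (ennreal (t powr (d / 2 - 1) * exp (- 1 * t)) * indicator {0<..} t) \<partial>lborel)"
  proof (rule nn_integral_cong)
    fix t :: real
    show "(\<integral>\<^sup>+x. ?K x t \<partial>?M) = ennreal (pi powr (d / 2)) * (ennreal (t powr (d / 2 - 1) * exp (- 1 * t)) * indicator {0<..} t)"
    proof (cases "t > 0")
      case True
      have "(\<integral>\<^sup>+x. ?K x t \<partial>?M) = (\<integral>\<^sup>+x. ennreal (t powr (d - 1) * exp (- t)) * ennreal (exp (- t * (norm x)\<^sup>2)) \<partial>?M)"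
        using True by (intro nn_integral_cong) (simp add: ennreal_mult'[symmetric] exp_add[symmetric] algebra_simps)
      also have "\<dots> = ennreal (t powr (d - 1) * exp (- t)) * ennreal ((pi / t) powr (d / 2))"
        using nn_integral_gaussian_euclidean[OF True, where 'a = 'a]
        by (subst nn_integral_cmult) (auto simp: d_def)
      also have "\<dots> = ennreal (pi powr (d / 2)) * (ennreal (t powr (d / 2 - 1) * exp (- 1 * t)))"
        using True powr_diff[of t "d - 1" "d / 2"]
        by (simp add: ennreal_mult'[symmetric] powr_divide algebra_simps)
      finally show ?thesis using True by simp
    qed simp
  qed
  also have "\<dots> = ennreal (pi powr (d / 2)) * ennreal (Gamma (d / 2))"
    using d by (subst nn_integral_cmult) (auto simp: nn_integral_exp_Gamma[of 1 "d / 2", simplified])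
  finally have *: "ennreal (Gamma d) * (\<integral>\<^sup>+x. ennreal (1 / (1 + (norm x)\<^sup>2) ^ DIM('a)) \<partial>?M) = ennreal (pi powr (d / 2) * Gamma (d / 2))"
    by (simp add: ennreal_mult')
  have G: "Gamma d > 0" using d by (rule Gamma_real_pos)
  have "(\<integral>\<^sup>+x. ennreal (1 / (1 + (norm x)\<^sup>2) ^ DIM('a)) \<partial>?M)
     = ennreal (1 / Gamma d) * (ennreal (Gamma d) * (\<integral>\<^sup>+x. ennreal (1 / (1 + (norm x)\<^sup>2) ^ DIM('a)) \<partial>?M))"
    using G by (simp add: mult.assoc[symmetric] ennreal_mult'[symmetric])
  also have "\<dots> = ennreal (pi powr (d / 2) * Gamma (d / 2) / Gamma d)"
    unfolding * using G d by (subst ennreal_mult'[symmetric]) (auto simp: less_imp_le)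
  finally show ?thesis unfolding d_def .
qed

lemma nn_integral_lborel_affine:
  fixes t :: "'a::euclidean_space"
  assumes [measurable]: "f \<in> borel_measurable borel" and c: "c \<noteq> 0"
  shows "(\<integral>\<^sup>+x. f x \<partial>lborel) = ennreal (\<bar>c\<bar> ^ DIM('a)) * (\<integral>\<^sup>+x. f (t + c *\<^sub>R x) \<partial>lborel)"
  by (subst lborel_affine[OF c, of t])
     (simp add: nn_integral_density nn_integral_distr nn_integral_cmult ennreal_power)

text \<open>The Jacobian gives s^d and the weight gives s^(-2d), in total s^(-d). The set has to be
  invariant under the substitution, as the whole space always is.\<close>

lemma nn_integral_conformal_weight_affine:
  fixes S :: "'a::euclidean_space set"
  assumes [measurable]: "S \<in> sets borel" and s: "s > 0"
    and inv: "\<And>x. t + s *\<^sub>R x \<in> S \<longleftrightarrow> x \<in> S"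
  shows "(\<integral>\<^sup>+x\<in>S. ennreal (1 / ((norm (x - t))\<^sup>2 + s\<^sup>2) ^ DIM('a)) \<partial>lborel)
     = ennreal (1 / s ^ DIM('a)) * (\<integral>\<^sup>+x\<in>S. ennreal (1 / (1 + (norm x)\<^sup>2) ^ DIM('a)) \<partial>lborel)"
proof -
  have "(\<integral>\<^sup>+x\<in>S. ennreal (1 / ((norm (x - t))\<^sup>2 + s\<^sup>2) ^ DIM('a)) \<partial>lborel)
    = ennreal (s ^ DIM('a)) * (\<integral>\<^sup>+x. ennreal (1 / ((norm (s *\<^sub>R x))\<^sup>2 + s\<^sup>2) ^ DIM('a)) * indicator S x \<partial>lborel)"
    using s inv by (subst nn_integral_lborel_affine[where c = s and t = t]) (auto simp: indicator_def)
  also have "(\<integral>\<^sup>+x. ennreal (1 / ((norm (s *\<^sub>R x))\<^sup>2 + s\<^sup>2) ^ DIM('a)) * indicator S x \<partial>lborel)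
    = (\<integral>\<^sup>+x. ennreal (1 / s ^ (2 * DIM('a))) * (ennreal (1 / (1 + (norm x)\<^sup>2) ^ DIM('a)) * indicator S x) \<partial>lborel)"
  proof (rule nn_integral_cong)
    fix x :: 'a
    have "(norm (s *\<^sub>R x))\<^sup>2 + s\<^sup>2 = s\<^sup>2 * (1 + (norm x)\<^sup>2)"
      using s by (simp add: power_mult_distrib algebra_simps)
    then have "1 / ((norm (s *\<^sub>R x))\<^sup>2 + s\<^sup>2) ^ DIM('a) = 1 / s ^ (2 * DIM('a)) * (1 / (1 + (norm x)\<^sup>2) ^ DIM('a))"
      by (simp add: power_mult_distrib power_mult)
    then show "ennreal (1 / ((norm (s *\<^sub>R x))\<^sup>2 + s\<^sup>2) ^ DIM('a)) * indicator S x
      = ennreal (1 / s ^ (2 * DIM('a))) * (ennreal (1 / (1 + (norm x)\<^sup>2) ^ DIM('a)) * indicator S x)"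
      using s by (simp only: ennreal_mult'' mult.assoc) (simp add: ennreal_mult''[symmetric] mult.assoc[symmetric])
  qed
  also have "\<dots> = ennreal (1 / s ^ (2 * DIM('a))) * (\<integral>\<^sup>+x\<in>S. ennreal (1 / (1 + (norm x)\<^sup>2) ^ DIM('a)) \<partial>lborel)"
    by (rule nn_integral_cmult) auto
  also have "ennreal (s ^ DIM('a)) * \<dots> = ennreal (1 / s ^ DIM('a)) * (\<integral>\<^sup>+x\<in>S. ennreal (1 / (1 + (norm x)\<^sup>2) ^ DIM('a)) \<partial>lborel)"
    using s by (simp add: mult.assoc[symmetric] ennreal_mult'[symmetric] mult_2 power_add)
  finally show ?thesis .
qed

section \<open>Reverse Hoelder inequality\<close>

text \<open>If the right-hand side is finite, Young's inequality with a free parameter \<tau> is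
  integrated and then optimised over \<tau>. The choice of \<theta> enters as d (1 - \<theta>) =
  \<theta>.\<close>

lemma reverse_Hoelder:
  fixes u w :: "'a \<Rightarrow> real" and d :: nat
  assumes [measurable]: "u \<in> borel_measurable M" "w \<in> borel_measurable M"
    and u: "\<And>x. x \<in> space M \<Longrightarrow> 0 \<le> u x" and w: "\<And>x. x \<in> space M \<Longrightarrow> 0 < w x"
    and d: "d > 0" and W: "W > 0" "(\<integral>\<^sup>+x. ennreal (1 / w x ^ d) \<partial>M) = ennreal W"
    and \<theta>: "\<theta> = d / (d + 1)"
  shows "ennreal ((LINT x|M. u x powr \<theta>) powr (1 / \<theta>) * W powr (- 1 / d)) \<le> (\<integral>\<^sup>+x. ennreal (u x * w x) \<partial>M)"
proof (cases "(\<integral>\<^sup>+x. ennreal (u x * w x) \<partial>M) = \<infinity>")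
  case False
  have \<theta>01: "0 < \<theta>" "\<theta> < 1" "1 - \<theta> = 1 / (d + 1)" using d by (auto simp: \<theta> field_simps)
  define U where "U = (LINT x|M. u x * w x)"
  have uw0: "AE x in M. 0 \<le> u x * w x"
    by (rule AE_I2) (simp add: u less_imp_le w)
  have iuw: "integrable M (\<lambda>x. u x * w x)"
    using False uw0 by (intro integrableI_nonneg) (auto simp: less_top)
  have U: "(\<integral>\<^sup>+x. ennreal (u x * w x) \<partial>M) = ennreal U" "U \<ge> 0"
    unfolding U_def using iuw uw0 by (auto intro: nn_integral_eq_integral integral_nonneg_AE)
  have w0: "AE x in M. 0 \<le> 1 / w x ^ d"
    by (rule AE_I2) (simp add: less_imp_le w)
  have iw: "integrable M (\<lambda>x. 1 / w x ^ d)"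
    using W w0 by (intro integrableI_nonneg) auto
  have Wi: "(LINT x|M. 1 / w x ^ d) = W"
    using W w0 iw by (simp add: integral_eq_nn_integral)
  define \<Phi> where "\<Phi> = (LINT x|M. u x powr \<theta>)"
  have \<Phi>0: "\<Phi> \<ge> 0" unfolding \<Phi>_def by simp
  \<comment> \<open>With b = \<tau> w, write u^\<theta> = (u b)^\<theta> (b^(-d))^(1-\<theta>): the
    powers of b cancel because d (1 - \<theta>) = \<theta>.\<close>
  have Young: "u x powr \<theta> \<le> \<theta> * \<tau> * (u x * w x) + (1 - \<theta>) / \<tau> ^ d * (1 / w x ^ d)"
    if "x \<in> space M" "\<tau> > 0" for x \<tau>
  proof (cases "u x = 0")
    case True
    then show ?thesis using \<theta>01 w[OF that(1)] that(2) by simp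
  next
    case False
    then have ux: "u x > 0" using u[OF that(1)] by simp
    define b where "b = \<tau> * w x"
    have b: "b > 0" using that w by (simp add: b_def)
    have "(u x * b) powr \<theta> * (1 / b ^ d) powr (1 - \<theta>) \<le> \<theta> * (u x * b) + (1 - \<theta>) * (1 / b ^ d)"
      using \<theta>01 ux b by (intro Youngs_inequality_0) auto
    also have "(1 / b ^ d) powr (1 - \<theta>) = b powr (- \<theta>)"
      unfolding \<theta>01(3) using b by (simp add: powr_realpow[symmetric] powr_minus_divide[symmetric] powr_powr \<theta>)
    also have "(u x * b) powr \<theta> * b powr (- \<theta>) = u x powr \<theta>"
      using b by (simp add: powr_mult powr_minus field_simps)
    finally show ?thesis by (simp add: b_def power_mult_distrib algebra_simps)
  qed
  \<comment> \<open>The case \<tau> = 1 already dominates \<open>u x powr \<theta>\<close> by an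
    integrable function.\<close>
  have i\<Phi>: "integrable M (\<lambda>x. u x powr \<theta>)"
  proof (rule Bochner_Integration.integrable_bound)
    show "integrable M (\<lambda>x. \<theta> * 1 * (u x * w x) + (1 - \<theta>) / 1 ^ d * (1 / w x ^ d))"
      using iuw iw by (intro Bochner_Integration.integrable_add integrable_mult_right) auto
    show "AE x in M. norm (u x powr \<theta>) \<le> norm (\<theta> * 1 * (u x * w x) + (1 - \<theta>) / 1 ^ d * (1 / w x ^ d))"
      by (rule AE_I2) (use Young[of _ 1] in force)
  qed auto
  have bound: "\<Phi> \<le> \<theta> * \<tau> * U + (1 - \<theta>) / \<tau> ^ d * W" if "\<tau> > 0" for \<tau>
  proof -
    have "\<Phi> \<le> (LINT x|M. \<theta> * \<tau> * (u x * w x) + (1 - \<theta>) / \<tau> ^ d * (1 / w x ^ d))"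
      unfolding \<Phi>_def
      using iuw iw Young[OF _ that] i\<Phi>
      by (intro integral_mono Bochner_Integration.integrable_add integrable_mult_right) auto
    also have "\<dots> = \<theta> * \<tau> * U + (1 - \<theta>) / \<tau> ^ d * W"
      using iuw iw unfolding U_def Wi[symmetric]
      by (subst Bochner_Integration.integral_add) (auto simp del: times_divide_eq_right)
    finally show ?thesis .
  qed
  have "\<Phi> powr (1 / \<theta>) * W powr (- 1 / d) \<le> U"
  \<comment> \<open>The optimal \<tau> has U in its denominator. If U = 0, positivity of w makes u
    vanish almost everywhere.\<close>
  proof (cases "U = 0")
    case True
    have "AE x in M. u x * w x = 0"
      using True iuw uw0 unfolding U_def by (subst (asm) integral_nonneg_eq_0_iff_AE) auto
    then have "AE x in M. u x powr \<theta> = 0"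
      by (rule AE_mp) (rule AE_I2, use w in force)
    then have "\<Phi> = 0" unfolding \<Phi>_def by (subst integral_cong_AE[where g = "\<lambda>_. 0"]) auto
    then show ?thesis using True by simp
  next
    case False
    then have U0: "U > 0" using U(2) by simp
    \<comment> \<open>The minimiser of the bound: it satisfies \<tau>^(d+1) = W / U, so that \<tau>
      U and W / \<tau>^d coincide.\<close>
    define \<tau> where "\<tau> = (W / U) powr (1 - \<theta>)"
    have \<tau>: "\<tau> > 0" using W U0 by (simp add: \<tau>_def)
    have 1: "\<tau> * U = W powr (1 - \<theta>) * U powr \<theta>"
      using U0 W by (simp add: \<tau>_def powr_divide powr_diff field_simps)
    have \<tau>d: "\<tau> ^ d = (W / U) powr \<theta>"
      using W U0 d unfolding \<tau>_def \<theta>01(3) by (simp add: powr_realpow[symmetric] powr_powr \<theta>)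
    have 2: "W / \<tau> ^ d = W powr (1 - \<theta>) * U powr \<theta>"
      unfolding \<tau>d using U0 W by (simp add: powr_divide powr_diff field_simps)
    have "\<Phi> \<le> \<theta> * (\<tau> * U) + (1 - \<theta>) * (W / \<tau> ^ d)"
      using bound[OF \<tau>] by (simp add: algebra_simps)
    also have "\<dots> = W powr (1 - \<theta>) * U powr \<theta>"
      unfolding 1 2 by (simp add: algebra_simps)
    finally have "\<Phi> powr (1 / \<theta>) \<le> (W powr (1 - \<theta>) * U powr \<theta>) powr (1 / \<theta>)"
      using \<Phi>0 \<theta>01 by (intro powr_mono2) auto
    also have "\<dots> = W powr (1 / d) * U"
    proof -
      have "(1 - \<theta>) * (1 / \<theta>) = 1 / d" using d unfolding \<theta>01(3) by (simp add: \<theta> field_simps)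
      then show ?thesis using U0 \<theta>01 by (simp add: powr_mult powr_powr)
    qed
    finally have "\<Phi> powr (1 / \<theta>) * W powr (- 1 / d) \<le> W powr (1 / d) * U * W powr (- 1 / d)"
      by (intro mult_right_mono) auto
    also have "\<dots> = U" using W by (simp add: powr_minus field_simps)
    finally show ?thesis .
  qed
  then show ?thesis unfolding U(1) \<Phi>_def by (rule ennreal_leI)
qed simp

lemma nn_integral_lebesgue_on_eq_lborel:
  fixes S :: "'a::euclidean_space set"
  assumes "S \<in> sets borel"
  shows "(\<integral>\<^sup>+x. f x \<partial>lebesgue_on S) = (\<integral>\<^sup>+x\<in>S. f x \<partial>lborel)"
  using assms by (simp add: nn_integral_restrict_space nn_integral_completion)

lemma Lquasinorm_nonneg [simp]: "0 \<le> Lquasinorm \<theta> S u"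
  by (simp add: Lquasinorm_def)

text \<open>The exponent \<open>DIM/(DIM + 1)\<close> is the one for which the dual weight
  \<open>(|x - t|\<^sup>2 + s\<^sup>2)\<^bsup>-DIM\<^esup>\<close> has an integral that depends on \<open>s\<close> by scaling only; both
  exponents of the theorem are of this form.\<close>

lemma Lquasinorm_le_weighted_integral:
  fixes S :: "'a::euclidean_space set"
  assumes S: "S \<in> sets borel" and s: "s > 0"
    and inv: "\<And>x. t + s *\<^sub>R x \<in> S \<longleftrightarrow> x \<in> S"
    and J: "J > 0" "(\<integral>\<^sup>+x\<in>S. ennreal (1 / (1 + (norm x)\<^sup>2) ^ DIM('a)) \<partial>lborel) = ennreal J"
    and \<theta>: "\<theta> = DIM('a) / (DIM('a) + 1)"
    and u: "u \<in> borel_measurable (lebesgue_on S)" "\<And>x. x \<in> S \<Longrightarrow> 0 \<le> u x"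
  shows "ennreal (s * (Lquasinorm \<theta> S u * J powr (- 1 / DIM('a))))
    \<le> (\<integral>\<^sup>+x. ennreal (u x * ((norm (x - t))\<^sup>2 + s\<^sup>2)) \<partial>lebesgue_on S)"
proof -
  define W where "W = J / s ^ DIM('a)"
  have W: "W > 0" using J s by (simp add: W_def)
  have W': "(\<integral>\<^sup>+x. ennreal (1 / ((norm (x - t))\<^sup>2 + s\<^sup>2) ^ DIM('a)) \<partial>lebesgue_on S) = ennreal W"
    using S s inv J
    by (simp add: nn_integral_lebesgue_on_eq_lborel nn_integral_conformal_weight_affine
          ennreal_mult'[symmetric] W_def)
  have meas: "(\<lambda>x. (norm (x - t))\<^sup>2 + s\<^sup>2) \<in> borel_measurable (lebesgue_on S)"
    by (intro measurable_restrict_space1 measurable_completion) simp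
  have "(s ^ DIM('a)) powr (1 / DIM('a)) = s"
    using s by (simp add: powr_realpow[symmetric] powr_powr)
  \<comment> \<open>W scales like s^(-DIM), so the power -1/DIM makes the lower bound linear in
    s.\<close>
  then have Wp: "W powr (- 1 / DIM('a)) = s * J powr (- 1 / DIM('a))"
    using s by (simp add: W_def powr_divide powr_minus) (simp add: divide_inverse)
  have "(LINT x|lebesgue_on S. u x powr \<theta>) = (LINT x|lebesgue_on S. \<bar>u x\<bar> powr \<theta>)"
    by (rule Bochner_Integration.integral_cong) (use u in auto)
  then have "Lquasinorm \<theta> S u = (LINT x|lebesgue_on S. u x powr \<theta>) powr (1 / \<theta>)"
    by (simp add: Lquasinorm_def)
  moreover have "ennreal ((LINT x|lebesgue_on S. u x powr \<theta>) powr (1 / \<theta>) * W powr (- 1 / DIM('a)))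
    \<le> (\<integral>\<^sup>+x. ennreal (u x * ((norm (x - t))\<^sup>2 + s\<^sup>2)) \<partial>lebesgue_on S)"
    using u W W' s by (intro reverse_Hoelder meas) (auto simp: \<theta> add_nonneg_pos)
  ultimately show ?thesis unfolding Wp by (simp add: mult_ac)
qed

section \<open>Second moments and a discriminant bound\<close>

text \<open>The parallel axis theorem. A single finite value with z > 0 controls the mass and the
  second moment about b, hence also the first moment; all other centres follow by expanding the
  square.\<close>

lemma nn_integral_second_moment:
  fixes f :: "'a::euclidean_space \<Rightarrow> real"
  assumes f [measurable]: "f \<in> borel_measurable lebesgue" and nonneg: "\<And>x. 0 \<le> f x"
    and z: "z > 0" and fin: "(\<integral>\<^sup>+x. ennreal (f x * ((norm (x - b))\<^sup>2 + z\<^sup>2)) \<partial>lebesgue) < \<infinity>"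
  obtains F V a where "F \<ge> 0" "V \<ge> 0"
    "\<And>c \<zeta>. (\<integral>\<^sup>+x. ennreal (f x * ((norm (x - c))\<^sup>2 + \<zeta>\<^sup>2)) \<partial>lebesgue)
              = ennreal (V + F * ((norm (c - a))\<^sup>2 + \<zeta>\<^sup>2))"
proof -
  have [measurable]: "(\<lambda>x. x) \<in> borel_measurable (lebesgue :: 'a measure)"
    by (simp add: measurable_completion)
  have P: "integrable lebesgue (\<lambda>x. f x * ((norm (x - b))\<^sup>2 + z\<^sup>2))"
    using fin nonneg by (intro integrableI_nonneg) auto
  have i0: "integrable lebesgue f"
  proof (rule Bochner_Integration.integrable_bound)
    show "integrable lebesgue (\<lambda>x. 1 / z\<^sup>2 * (f x * ((norm (x - b))\<^sup>2 + z\<^sup>2)))"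
      using P by (rule integrable_mult_right)
    show "AE x in lebesgue. norm (f x) \<le> norm (1 / z\<^sup>2 * (f x * ((norm (x - b))\<^sup>2 + z\<^sup>2)))"
      using z nonneg by (intro AE_I2) (simp add: field_simps)
  qed auto
  have i2: "integrable lebesgue (\<lambda>x. f x * (norm (x - b))\<^sup>2)"
    using nonneg
    by (intro Bochner_Integration.integrable_bound[OF P]) (auto intro!: mult_left_mono AE_I2)
  have i1: "integrable lebesgue (\<lambda>x. f x *\<^sub>R (x - b))"
  proof (rule Bochner_Integration.integrable_bound)
    show "integrable lebesgue (\<lambda>x. f x + f x * (norm (x - b))\<^sup>2)"
      using i0 i2 by (rule Bochner_Integration.integrable_add)
    have "f x * norm (x - b) \<le> f x + f x * (norm (x - b))\<^sup>2" for x
    proof -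
      have "r \<le> 1 + r\<^sup>2" for r :: real using zero_le_power2[of "r - 1/2"] by (simp add: power2_eq_square algebra_simps)
      then have "f x * norm (x - b) \<le> f x * (1 + (norm (x - b))\<^sup>2)"
        using nonneg by (intro mult_left_mono)
      then show ?thesis by (simp add: algebra_simps)
    qed
    then show "AE x in lebesgue. norm (f x *\<^sub>R (x - b)) \<le> norm (f x + f x * (norm (x - b))\<^sup>2)"
      using nonneg by (intro AE_I2) simp
  qed auto
  define F where "F = (LINT x|lebesgue. f x)"
  define F1 where "F1 = (LINT x|lebesgue. f x *\<^sub>R (x - b))"
  define F2 where "F2 = (LINT x|lebesgue. f x * (norm (x - b))\<^sup>2)"
  \<comment> \<open>The barycenter. For F = 0 division by zero yields a = b and V = F2, and
    \<open>F0\<close> makes all moments vanish, so the formula persists.\<close>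
  define a where "a = b + (1 / F) *\<^sub>R F1"
  define V where "V = F2 - (norm F1)\<^sup>2 / F"
  have F: "F \<ge> 0" using nonneg by (simp add: F_def)
  have F0: "F1 = 0 \<and> F2 = 0" if "F = 0"
  proof -
    have "AE x in lebesgue. f x = 0"
      using that i0 nonneg unfolding F_def by (subst (asm) integral_nonneg_eq_0_iff_AE) auto
    then have "AE x in lebesgue. f x *\<^sub>R (x - b) = 0" "AE x in lebesgue. f x * (norm (x - b))\<^sup>2 = 0"
      by auto
    then show ?thesis unfolding F1_def F2_def by (auto intro: integral_eq_zero_AE)
  qed
  have expand: "f x * ((norm (x - c))\<^sup>2 + \<zeta>\<^sup>2)
    = f x * (norm (x - b))\<^sup>2 + 2 * ((f x *\<^sub>R (x - b)) \<bullet> (b - c)) + f x * ((norm (b - c))\<^sup>2 + \<zeta>\<^sup>2)" for x c \<zeta>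
  proof -
    have "(norm (x - c))\<^sup>2 = (norm ((x - b) + (b - c)))\<^sup>2" by simp
    also have "\<dots> = (norm (x - b))\<^sup>2 + 2 * ((x - b) \<bullet> (b - c)) + (norm (b - c))\<^sup>2"
      by (simp only: power2_norm_eq_inner inner_add_left inner_add_right) (simp add: inner_commute)
    finally have *: "(norm (x - c))\<^sup>2 = \<dots>" .
    show ?thesis unfolding * by (simp add: distrib_left)
  qed
  have int: "has_bochner_integral lebesgue (\<lambda>x. f x * ((norm (x - c))\<^sup>2 + \<zeta>\<^sup>2))
      (F2 + 2 * (F1 \<bullet> (b - c)) + F * ((norm (b - c))\<^sup>2 + \<zeta>\<^sup>2))" for c \<zeta>
    unfolding expand F_def F1_def F2_def using i0 i1 i2
    by (intro has_bochner_integral_add has_bochner_integral_mult_right has_bochner_integral_mult_left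
        has_bochner_integral_inner_left has_bochner_integral_integrable) auto
  have val: "F2 + 2 * (F1 \<bullet> (b - c)) + F * ((norm (b - c))\<^sup>2 + \<zeta>\<^sup>2) = V + F * ((norm (c - a))\<^sup>2 + \<zeta>\<^sup>2)" for c \<zeta>
  proof (cases "F = 0")
    case True
    then show ?thesis using F0 by (simp add: V_def)
  next
    case False
    have "(norm (c - a))\<^sup>2 = (norm ((b - c) + (1 / F) *\<^sub>R F1))\<^sup>2"
      by (simp add: a_def norm_minus_commute algebra_simps)
    also have "\<dots> = (norm (b - c))\<^sup>2 + 2 / F * (F1 \<bullet> (b - c)) + (norm F1)\<^sup>2 / F\<^sup>2"
      by (simp only: power2_norm_eq_inner inner_add_left inner_add_right)
         (simp add: inner_commute power2_eq_square)
    finally show ?thesis using False by (simp add: V_def field_simps power2_eq_square)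
  qed
  have eq: "(LINT x|lebesgue. f x * ((norm (x - c))\<^sup>2 + \<zeta>\<^sup>2)) = V + F * ((norm (c - a))\<^sup>2 + \<zeta>\<^sup>2)" for c \<zeta>
    using int[of c \<zeta>] unfolding val by (rule has_bochner_integral_integral_eq)
  show ?thesis
  proof (rule that)
    show "F \<ge> 0" by (rule F)
    \<comment> \<open>The sign of V is not visible in its definition, but V is the second moment
      about a.\<close>
    have "V = (LINT x|lebesgue. f x * ((norm (x - a))\<^sup>2 + 0\<^sup>2))" using eq[of a 0] by simp
    also have "\<dots> \<ge> 0" using nonneg by (intro integral_nonneg_AE) auto
    finally show "V \<ge> 0" .
    show "(\<integral>\<^sup>+x. ennreal (f x * ((norm (x - c))\<^sup>2 + \<zeta>\<^sup>2)) \<partial>lebesgue) = ennreal (V + F * ((norm (c - a))\<^sup>2 + \<zeta>\<^sup>2))" for c \<zeta>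
      unfolding eq[symmetric] using int[of c \<zeta>] nonneg
      by (intro nn_integral_eq_integral) (auto simp: has_bochner_integral_iff)
  qed
qed

text \<open>F = 0 is impossible because s K would be bounded. Otherwise the parabola V - K s + F s^2
  has its minimum at the positive point K / (2 F), and its value there is nonnegative.\<close>

lemma discriminant_of_lower_bound:
  fixes F V K :: real
  assumes "K > 0" "F \<ge> 0" and le: "\<And>s. s > 0 \<Longrightarrow> s * K \<le> V + F * s\<^sup>2" and V: "V \<ge> 0"
  shows "F > 0" "K\<^sup>2 \<le> 4 * F * V"
proof -
  show F: "F > 0"
  proof (rule ccontr)
    assume "\<not> F > 0"
    then show False using le[of "(V + 1) / K"] assms by simp
  qed
  have "K / (2 * F) * K \<le> V + F * (K / (2 * F))\<^sup>2" using F assms by (intro le) simp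
  then show "K\<^sup>2 \<le> 4 * F * V" using F by (simp add: field_simps power2_eq_square)
qed

section \<open>The half space and its reflection\<close>

lemma half_space_borel [measurable]: "(half_space :: ((real ^ 'm::finite) \<times> real) set) \<in> sets borel"
proof -
  have "(half_space :: ((real ^ 'm) \<times> real) set) = {y. 0 < snd y}" by (auto simp: half_space_def)
  also have "open \<dots>" by (intro open_Collect_less continuous_intros)
  finally show ?thesis by simp
qed

text \<open>The map from y to -y exchanges the two open half spaces, and the hyperplane between them
  is a null set.\<close>

lemma nn_integral_half_space:
  fixes F :: "(real ^ 'm::finite) \<times> real \<Rightarrow> ennreal"
  assumes [measurable]: "F \<in> borel_measurable borel" and even: "\<And>y. F (- y) = F y"
  shows "(\<integral>\<^sup>+y. F y \<partial>lborel) = 2 * (\<integral>\<^sup>+y\<in>half_space. F y \<partial>lborel)"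
proof -
  let ?N = "{y :: (real ^ 'm) \<times> real. (0, 1) \<bullet> y = 0}"
  have "negligible ?N" by (rule negligible_hyperplane) (simp add: zero_prod_def)
  then have "AE y in lebesgue. y \<notin> ?N" using negligible_iff_null_sets AE_not_in by blast
  then have "AE y in lebesgue. F y = F y * indicator half_space y + F (- y) * indicator half_space (- y)"
    by (rule AE_mp) (rule AE_I2, auto simp: half_space_def indicator_def even)
  then have "(\<integral>\<^sup>+y. F y \<partial>lborel) = (\<integral>\<^sup>+y. F y * indicator half_space y + F (- y) * indicator half_space (- y) \<partial>lebesgue)"
    by (subst nn_integral_completion[symmetric]) (rule nn_integral_cong_AE)
  also have "\<dots> = (\<integral>\<^sup>+y\<in>half_space. F y \<partial>lborel) + (\<integral>\<^sup>+y. F (- y) * indicator half_space (- y) \<partial>lborel)"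
    unfolding nn_integral_completion by (rule nn_integral_add) auto
  also have "(\<integral>\<^sup>+y. F (- y) * indicator half_space (- y) \<partial>lborel) = (\<integral>\<^sup>+y\<in>half_space. F y \<partial>lborel)"
    by (subst nn_integral_lborel_affine[where c = "-1" and t = 0, of "\<lambda>y. F y * indicator half_space y"]) auto
  finally show ?thesis by (simp add: mult_2)
qed

section \<open>Lower bound for the interaction\<close>

text \<open>Nonnegativity of g on the half space lets it leave the inner integral, which then
  depends on f alone.\<close>

lemma interaction_eq:
  fixes f :: "real ^ 'm::finite \<Rightarrow> real"
  assumes [measurable]: "f \<in> borel_measurable lebesgue" and f: "\<And>x. 0 \<le> f x"
    and g: "\<And>y. y \<in> half_space \<Longrightarrow> 0 \<le> g y"
  shows "interaction f g = (\<integral>\<^sup>+y. ennreal (g y) *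
    (\<integral>\<^sup>+x. ennreal (f x * ((norm (x - fst y))\<^sup>2 + (snd y)\<^sup>2)) \<partial>lebesgue) \<partial>lebesgue_on half_space)"
  unfolding interaction_def
proof (rule nn_integral_cong)
  fix y :: "(real ^ 'm) \<times> real" assume "y \<in> space (lebesgue_on half_space)"
  then have gy: "0 \<le> g y" using g by simp
  have [measurable]: "(\<lambda>x. x) \<in> borel_measurable (lebesgue :: (real ^ 'm) measure)"
    by (simp add: measurable_completion)
  have "(dist (x, 0) y)\<^sup>2 = (norm (x - fst y))\<^sup>2 + (snd y)\<^sup>2" for x
    by (cases y) (simp add: dist_Pair_Pair dist_norm[symmetric])
  then have "(\<integral>\<^sup>+x. ennreal (f x * (dist (x, 0) y)\<^sup>2 * g y) \<partial>lebesgue)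
     = (\<integral>\<^sup>+x. ennreal (g y) * ennreal (f x * ((norm (x - fst y))\<^sup>2 + (snd y)\<^sup>2)) \<partial>lebesgue)"
    using gy by (simp add: ennreal_mult'[symmetric] mult.commute)
  also have "\<dots> = ennreal (g y) * (\<integral>\<^sup>+x. ennreal (f x * ((norm (x - fst y))\<^sup>2 + (snd y)\<^sup>2)) \<partial>lebesgue)"
    by (rule nn_integral_cmult) measurable
  finally show "(\<integral>\<^sup>+x. ennreal (f x * (dist (x, 0) y)\<^sup>2 * g y) \<partial>lebesgue)
     = ennreal (g y) * (\<integral>\<^sup>+x. ennreal (f x * ((norm (x - fst y))\<^sup>2 + (snd y)\<^sup>2)) \<partial>lebesgue)" .
qed

lemma norm_diff_horizontal:
  fixes y :: "'a::euclidean_space \<times> real"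
  shows "(norm (y - (a, 0)))\<^sup>2 = (norm (fst y - a))\<^sup>2 + (snd y)\<^sup>2"
  by (cases y) (simp add: norm_Pair)

lemma interaction_lower_bound:
  fixes f :: "real ^ 'm::finite \<Rightarrow> real" and g :: "(real ^ 'm) \<times> real \<Rightarrow> real"
  assumes A: "A > 0" "(\<integral>\<^sup>+x. ennreal (1 / (1 + (norm x)\<^sup>2) ^ CARD('m)) \<partial>(lborel :: (real ^ 'm) measure)) = ennreal A"
    and B: "B > 0" "(\<integral>\<^sup>+y\<in>(half_space :: ((real ^ 'm) \<times> real) set).
        ennreal (1 / (1 + (norm y)\<^sup>2) ^ (CARD('m) + 1)) \<partial>lborel) = ennreal B"
    and p: "p = CARD('m) / (CARD('m) + 1)" and r: "r = (CARD('m) + 1) / (CARD('m) + 2)"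
    and fm: "f \<in> borel_measurable lebesgue" and f: "\<And>x. 0 \<le> f x"
    and gm: "g \<in> borel_measurable (lebesgue_on half_space)" and g: "\<And>y. y \<in> half_space \<Longrightarrow> 0 \<le> g y"
  shows "ennreal (A powr (- 1 / CARD('m)) * B powr (- 1 / (CARD('m) + 1)) / 2
            * Lquasinorm p UNIV f * Lquasinorm r half_space g) \<le> interaction f g"
proof -
  let ?H = "half_space :: ((real ^ 'm) \<times> real) set"
  define h where "h y = (\<integral>\<^sup>+x. ennreal (f x * ((norm (x - fst y))\<^sup>2 + (snd y)\<^sup>2)) \<partial>lebesgue)"
    for y :: "(real ^ 'm) \<times> real"
  define K where "K = Lquasinorm p UNIV f * A powr (- 1 / CARD('m))"
  define L where "L = Lquasinorm r half_space g * B powr (- 1 / (CARD('m) + 1))"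
  have KL0: "K \<ge> 0" "L \<ge> 0" by (simp_all add: K_def L_def)
  have Ib: "interaction f g = (\<integral>\<^sup>+y. ennreal (g y) * h y \<partial>lebesgue_on ?H)"
    unfolding h_def by (rule interaction_eq[OF fm f g])
  have boundf: "ennreal (s * K) \<le> (\<integral>\<^sup>+x. ennreal (f x * ((norm (x - t))\<^sup>2 + s\<^sup>2)) \<partial>lebesgue)" if "s > 0" for s t
    using Lquasinorm_le_weighted_integral[of UNIV s t A p f] that A p fm f
    by (simp add: lebesgue_on_UNIV_eq K_def)
  \<comment> \<open>The dilation about the centre preserves the half space because the centre (a, 0)
    lies on the boundary.\<close>
  have boundg: "ennreal (s * L) \<le> (\<integral>\<^sup>+y. ennreal (g y * ((norm (y - (a, 0)))\<^sup>2 + s\<^sup>2)) \<partial>lebesgue_on ?H)" if s: "s > 0" for s a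
  proof -
    have "(a, 0) + s *\<^sub>R y \<in> ?H \<longleftrightarrow> y \<in> ?H" for y
      using s by (simp add: half_space_def zero_less_mult_iff)
    then show ?thesis
      using Lquasinorm_le_weighted_integral[of ?H s "(a, 0)" B r g] s B r gm g
      by (simp add: L_def add.commute)
  qed
  have "ennreal (K * L / 2) \<le> interaction f g"
  \<comment> \<open>If \<open>h\<close> is infinite throughout the half space, the interaction is
    infinite unless g vanishes almost everywhere, and then its quasi-norm is 0. Otherwise one finite
    value, at positive height, makes \<open>h\<close> a quadratic polynomial.\<close>
  proof (cases "\<exists>y\<in>?H. h y < \<infinity>")
    case False
    then have "h y = \<infinity>" if "y \<in> ?H" for y
      using that by (metis infinity_ennreal_def less_top)
    then have "interaction f g = (\<integral>\<^sup>+y. \<infinity> * ennreal (g y) \<partial>lebesgue_on ?H)"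
      unfolding Ib by (intro nn_integral_cong) (simp add: mult.commute)
    also have "\<dots> = \<infinity> * (\<integral>\<^sup>+y. ennreal (g y) \<partial>lebesgue_on ?H)"
      using gm by (intro nn_integral_cmult) measurable
    finally have I: "interaction f g = \<infinity> * (\<integral>\<^sup>+y. ennreal (g y) \<partial>lebesgue_on ?H)" .
    show ?thesis
    proof (cases "(\<integral>\<^sup>+y. ennreal (g y) \<partial>lebesgue_on ?H) = 0")
      case True
      then have "AE y in lebesgue_on ?H. ennreal (g y) = 0"
        using gm by (subst (asm) nn_integral_0_iff_AE) auto
      then have "AE y in lebesgue_on ?H. \<bar>g y\<bar> powr r = 0"
        by (rule AE_mp) (rule AE_I2, use g in \<open>force simp: ennreal_eq_0_iff\<close>)
      then have "(LINT y|lebesgue_on ?H. \<bar>g y\<bar> powr r) = 0"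
        by (rule integral_eq_zero_AE)
      then have "L = 0" by (simp add: L_def Lquasinorm_def)
      then show ?thesis by simp
    next
      case False
      then show ?thesis using I by (simp add: ennreal_top_mult)
    qed
  next
    case True
    then obtain y0 where y0: "y0 \<in> ?H" "h y0 < \<infinity>" by auto
    obtain F V a where FV: "F \<ge> 0" "V \<ge> 0" and
      mom: "\<And>c \<zeta>. (\<integral>\<^sup>+x. ennreal (f x * ((norm (x - c))\<^sup>2 + \<zeta>\<^sup>2)) \<partial>lebesgue)
              = ennreal (V + F * ((norm (c - a))\<^sup>2 + \<zeta>\<^sup>2))"
      using nn_integral_second_moment[OF fm f, of "snd y0" "fst y0"] y0
      by (auto simp: h_def half_space_def)
    show ?thesis
    proof (cases "K = 0")
      case False
      then have K: "K > 0" using KL0 by simp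
      have le: "s * K \<le> V + F * s\<^sup>2" if "s > 0" for s
      proof -
        have "ennreal (s * K) \<le> ennreal (V + F * s\<^sup>2)" using boundf[OF that, of a] unfolding mom by simp
        moreover have "0 \<le> V + F * s\<^sup>2" using FV by simp
        ultimately show ?thesis using ennreal_le_iff by blast
      qed
      have F: "F > 0" and K2: "K\<^sup>2 \<le> 4 * F * V"
        using discriminant_of_lower_bound[OF K FV(1) le FV(2)] by auto
      have V: "V > 0"
        using K2 F FV(2) K by (cases "V = 0") auto
      \<comment> \<open>Chosen so that \<open>h\<close> is F times the weight centred at (a, 0) with
        parameter s. Moreover F s is the geometric mean of F and V, which the discriminant bounds
        below by K / 2.\<close>
      define s where "s = sqrt (V / F)"
      have s: "s > 0" "s\<^sup>2 = V / F" using F V by (auto simp: s_def)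
      have "(2 * (F * s))\<^sup>2 = 4 * F * V"
        using F by (simp add: power_mult_distrib s(2) power2_eq_square[of F])
      then have "K\<^sup>2 \<le> (2 * (F * s))\<^sup>2" using K2 by simp
      moreover have "0 \<le> 2 * (F * s)" using F s(1) by simp
      ultimately have Ks: "K \<le> 2 * (F * s)" by (rule power2_le_imp_le)
      have hy: "h y = ennreal (F * ((norm (y - (a, 0)))\<^sup>2 + s\<^sup>2))" for y
        unfolding h_def mom norm_diff_horizontal using F s by (simp add: field_simps)
      have wm: "(\<lambda>y. (norm (y - (a, 0)))\<^sup>2 + s\<^sup>2) \<in> borel_measurable (lebesgue_on ?H)"
        by (intro measurable_restrict_space1 measurable_completion) simp
      have "ennreal (K * L / 2) \<le> ennreal (F * (s * L))"
        using mult_right_mono[OF Ks KL0(2)] by (intro ennreal_leI) simp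
      also have "\<dots> = ennreal F * ennreal (s * L)" using F s KL0 by (simp add: ennreal_mult')
      also have "\<dots> \<le> ennreal F * (\<integral>\<^sup>+y. ennreal (g y * ((norm (y - (a, 0)))\<^sup>2 + s\<^sup>2)) \<partial>lebesgue_on ?H)"
        using boundg[OF s(1)] by (intro mult_left_mono) auto
      also have "\<dots> = (\<integral>\<^sup>+y. ennreal F * ennreal (g y * ((norm (y - (a, 0)))\<^sup>2 + s\<^sup>2)) \<partial>lebesgue_on ?H)"
        by (intro nn_integral_cmult[symmetric] measurable_compose[OF _ measurable_ennreal]
              borel_measurable_times gm wm)
      also have "\<dots> = interaction f g"
        unfolding Ib hy using F g by (intro nn_integral_cong) (simp add: ennreal_mult'[symmetric] algebra_simps)
      finally show ?thesis .
    qed simp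
  qed
  then show ?thesis by (simp add: K_def L_def algebra_simps)
qed

section \<open>Extremal functions\<close>

text \<open>The equality case of \<open>Lquasinorm_le_weighted_integral\<close> at \<open>t = 0\<close>, \<open>s = 1\<close>.\<close>

definition bubble :: "'a::euclidean_space \<Rightarrow> real" where
  "bubble x = 1 / (1 + (norm x)\<^sup>2) ^ (DIM('a) + 1)"

lemma one_plus_norm_sq_pos: "0 < 1 + (norm x)\<^sup>2"
  by (simp add: add_pos_nonneg)

lemma bubble_nonneg: "0 \<le> bubble x"
  using one_plus_norm_sq_pos[of x] by (simp add: bubble_def)

lemma bubble_measurable: "bubble \<in> borel_measurable borel"
  unfolding bubble_def[abs_def] by measurable

text \<open>Together with \<open>bubble_powr\<close> this explains extremality: the \<theta>-th
  power of \<open>bubble\<close> and its product with the weight are the same function, which is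
  equality in Young's inequality at \<tau> = 1.\<close>

lemma bubble_times_weight: "bubble x * (1 + (norm x)\<^sup>2) = 1 / (1 + (norm x)\<^sup>2) ^ DIM('a)" for x :: "'a::euclidean_space"
  using one_plus_norm_sq_pos[of x] by (simp add: bubble_def)

lemma bubble_powr:
  fixes x :: "'a::euclidean_space"
  shows "\<bar>bubble x\<bar> powr (DIM('a) / (DIM('a) + 1)) = 1 / (1 + (norm x)\<^sup>2) ^ DIM('a)"
  using one_plus_norm_sq_pos[of x] bubble_nonneg[of x]
  by (simp add: bubble_def powr_divide powr_powr powr_realpow[symmetric] del: of_nat_Suc power_Suc of_nat_add)

lemma bubble_Lspace:
  fixes S :: "'a::euclidean_space set"
  assumes S: "S \<in> sets borel"
    and J: "J \<ge> 0" "(\<integral>\<^sup>+x\<in>S. ennreal (1 / (1 + (norm x)\<^sup>2) ^ DIM('a)) \<partial>lborel) = ennreal J"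
    and \<theta>: "\<theta> = DIM('a) / (DIM('a) + 1)"
  shows "bubble \<in> Lspace \<theta> S" "Lquasinorm \<theta> S bubble = J powr (1 + 1 / DIM('a))"
proof -
  have m: "bubble \<in> borel_measurable (lebesgue_on S)"
    by (intro measurable_restrict_space1 measurable_completion) (simp add: bubble_measurable)
  have I: "(\<integral>\<^sup>+x. ennreal (\<bar>bubble x\<bar> powr \<theta>) \<partial>lebesgue_on S) = ennreal J"
    using S J unfolding \<theta> bubble_powr by (simp add: nn_integral_lebesgue_on_eq_lborel)
  show "bubble \<in> Lspace \<theta> S" using m I by (simp add: Lspace_def)
  have "(LINT x|lebesgue_on S. \<bar>bubble x\<bar> powr \<theta>) = J"
    using m J I by (subst integral_eq_nn_integral) auto
  then show "Lquasinorm \<theta> S bubble = J powr (1 + 1 / DIM('a))"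
    by (simp add: Lquasinorm_def \<theta> add_divide_distrib add.commute)
qed

text \<open>That V and F agree is what matters: the inner integral of the interaction becomes a
  multiple of 1 + |y|^2, the weight for which \<open>bubble\<close> is extremal on the half
  space.\<close>

lemma bubble_second_moment:
  assumes A: "A > 0" "(\<integral>\<^sup>+x. ennreal (1 / (1 + (norm x)\<^sup>2) ^ DIM('a)) \<partial>(lborel :: 'a::euclidean_space measure)) = ennreal A"
  shows "(\<integral>\<^sup>+x. ennreal (bubble x * ((norm (x - c))\<^sup>2 + \<zeta>\<^sup>2)) \<partial>(lebesgue :: 'a measure))
     = ennreal (A / 2 * (1 + ((norm c)\<^sup>2 + \<zeta>\<^sup>2)))"
proof -
  define \<theta> where "\<theta> = DIM('a) / (DIM('a) + 1)"
  have m: "(bubble :: 'a \<Rightarrow> real) \<in> borel_measurable lebesgue"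
    by (intro measurable_completion) (simp add: bubble_measurable)
  have one: "(\<integral>\<^sup>+x. ennreal (bubble x * ((norm (x - 0))\<^sup>2 + 1\<^sup>2)) \<partial>(lebesgue :: 'a measure)) = ennreal A"
    using A by (simp add: bubble_times_weight[simplified add.commute] nn_integral_completion add.commute)
  obtain F V a where FV: "F \<ge> 0" "V \<ge> 0" and
    mom: "\<And>c \<zeta>. (\<integral>\<^sup>+x. ennreal (bubble x * ((norm (x - c))\<^sup>2 + \<zeta>\<^sup>2)) \<partial>(lebesgue :: 'a measure))
            = ennreal (V + F * ((norm (c - a))\<^sup>2 + \<zeta>\<^sup>2))"
    using nn_integral_second_moment[OF m bubble_nonneg, of 1 0] one by auto
  \<comment> \<open>A^(1+1/d) times A^(-1/d): the general lower bound for \<open>bubble\<close>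
    becomes s A.\<close>
  have K: "Lquasinorm \<theta> UNIV (bubble :: 'a \<Rightarrow> real) * A powr (- 1 / DIM('a)) = A"
    using A bubble_Lspace(2)[of "UNIV :: 'a set" A \<theta>]
    by (simp add: \<theta>_def powr_add[symmetric] del: powr_add)
  \<comment> \<open>The bound is attained at \<open>s = 1\<close>, so \<open>V + F = A\<close>, while the bounds for all \<open>s\<close> give
    \<open>A\<^sup>2 \<le> 4 F V\<close>; hence \<open>F = V = A / 2\<close> without computing any moment.\<close>
  have le: "s * A \<le> V + F * s\<^sup>2" if "s > 0" for s
  proof -
    have "ennreal (s * (Lquasinorm \<theta> UNIV (bubble :: 'a \<Rightarrow> real) * A powr (- 1 / DIM('a))))
        \<le> (\<integral>\<^sup>+x. ennreal (bubble x * ((norm (x - a))\<^sup>2 + s\<^sup>2)) \<partial>lebesgue_on UNIV)"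
      using A m that
      by (intro Lquasinorm_le_weighted_integral) (auto simp: \<theta>_def lebesgue_on_UNIV_eq bubble_nonneg)
    then have "ennreal (s * A) \<le> (\<integral>\<^sup>+x. ennreal (bubble x * ((norm (x - a))\<^sup>2 + s\<^sup>2)) \<partial>(lebesgue :: 'a measure))"
      unfolding K lebesgue_on_UNIV_eq .
    then have "ennreal (s * A) \<le> ennreal (V + F * s\<^sup>2)" unfolding mom by simp
    moreover have "0 \<le> V + F * s\<^sup>2" using FV by simp
    ultimately show ?thesis using ennreal_le_iff by blast
  qed
  have F: "F > 0" and disc: "A\<^sup>2 \<le> 4 * F * V"
    using discriminant_of_lower_bound[OF A(1) FV(1) le FV(2)] by auto
  \<comment> \<open>The barycenter is located by evenness: the second moments about a and -a agree,
    but they are V and V + F |2a|^2.\<close>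
  have "(\<integral>\<^sup>+x. ennreal (bubble x * ((norm (x - a))\<^sup>2 + 0\<^sup>2)) \<partial>(lborel :: 'a measure))
     = (\<integral>\<^sup>+x. ennreal (bubble (- x) * ((norm (- x - a))\<^sup>2 + 0\<^sup>2)) \<partial>lborel)"
    using bubble_measurable
    by (subst nn_integral_lborel_affine[where c = "-1" and t = 0]) (measurable, simp_all)
  moreover have "bubble (- x) = bubble x" "norm (- x - a) = norm (x - (- a))" for x :: 'a
    using norm_minus_cancel[of "x + a"] by (simp_all add: bubble_def)
  ultimately have "(\<integral>\<^sup>+x. ennreal (bubble x * ((norm (x - a))\<^sup>2 + 0\<^sup>2)) \<partial>(lebesgue :: 'a measure))
     = (\<integral>\<^sup>+x. ennreal (bubble x * ((norm (x - (- a)))\<^sup>2 + 0\<^sup>2)) \<partial>lebesgue)"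
    unfolding nn_integral_completion by (simp only:)
  then have "V = V + F * (norm (- a - a))\<^sup>2"
    unfolding mom using FV by (simp add: ennreal_inj)
  then have "- a - a = 0" using F by simp
  moreover have "- a - a = (- 2) *\<^sub>R a" by (simp add: scaleR_2)
  ultimately have "(- 2) *\<^sub>R a = 0" by (simp only:)
  then have a: "a = 0" by simp
  have "ennreal (V + F) = ennreal A" using one unfolding mom a by simp
  then have VF: "V + F = A" using A FV by (subst (asm) ennreal_inj) auto
  have "(V - F)\<^sup>2 = (V + F)\<^sup>2 - 4 * F * V" by (simp add: power2_eq_square algebra_simps)
  then have "(V - F)\<^sup>2 \<le> 0" using disc VF by simp
  then have V: "V = F" and "A / 2 = F" using VF by simp_all
  then show ?thesis unfolding mom a by (simp add: algebra_simps)
qed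

text \<open>The factor 1 + |y|^2 from the inner integral cancels one power in
  \<open>bubble y\<close>, leaving A / 2 times the weight whose integral over the half space is
  B.\<close>

lemma interaction_bubble:
  assumes A: "A > 0" "(\<integral>\<^sup>+x. ennreal (1 / (1 + (norm x)\<^sup>2) ^ CARD('m)) \<partial>(lborel :: (real ^ 'm::finite) measure)) = ennreal A"
    and B: "B > 0" "(\<integral>\<^sup>+y\<in>(half_space :: ((real ^ 'm) \<times> real) set).
        ennreal (1 / (1 + (norm y)\<^sup>2) ^ (CARD('m) + 1)) \<partial>lborel) = ennreal B"
  shows "interaction (bubble :: real ^ 'm \<Rightarrow> real) bubble = ennreal (A * B / 2)"
proof -
  let ?H = "half_space :: ((real ^ 'm) \<times> real) set"
  have m: "(bubble :: real ^ 'm \<Rightarrow> real) \<in> borel_measurable lebesgue"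
    by (intro measurable_completion) (simp add: bubble_measurable)
  have "interaction (bubble :: real ^ 'm \<Rightarrow> real) bubble
     = (\<integral>\<^sup>+y. ennreal (bubble y) * ennreal (A / 2 * (1 + ((norm (fst y))\<^sup>2 + (snd y)\<^sup>2))) \<partial>lebesgue_on ?H)"
    using A by (subst interaction_eq[OF m bubble_nonneg bubble_nonneg]) (simp add: bubble_second_moment)
  also have "\<dots> = (\<integral>\<^sup>+y\<in>?H. ennreal (bubble y) * ennreal (A / 2 * (1 + ((norm (fst y))\<^sup>2 + (snd y)\<^sup>2))) \<partial>lborel)"
    by (rule nn_integral_lebesgue_on_eq_lborel) measurable
  also have "\<dots> = (\<integral>\<^sup>+y. ennreal (A / 2) * (ennreal (1 / (1 + (norm y)\<^sup>2) ^ (CARD('m) + 1)) * indicator ?H y) \<partial>lborel)"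
  proof (rule nn_integral_cong)
    fix y :: "(real ^ 'm) \<times> real"
    have "(norm (fst y))\<^sup>2 + (snd y)\<^sup>2 = (norm y)\<^sup>2" using norm_diff_horizontal[of y 0] by (simp add: zero_prod_def[symmetric])
    moreover have "bubble y * (A / 2 * (1 + (norm y)\<^sup>2)) = A / 2 * (1 / (1 + (norm y)\<^sup>2) ^ (CARD('m) + 1))"
    proof -
      have "bubble y * (A / 2 * (1 + (norm y)\<^sup>2)) = A / 2 * (bubble y * (1 + (norm y)\<^sup>2))" by simp
      then show ?thesis unfolding bubble_times_weight by simp
    qed
    ultimately have "ennreal (bubble y) * ennreal (A / 2 * (1 + ((norm (fst y))\<^sup>2 + (snd y)\<^sup>2)))
      = ennreal (A / 2) * ennreal (1 / (1 + (norm y)\<^sup>2) ^ (CARD('m) + 1))"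
      using A(1) bubble_nonneg[of y] by (metis ennreal_mult' half_gt_zero less_imp_le)
    then show "ennreal (bubble y) * ennreal (A / 2 * (1 + ((norm (fst y))\<^sup>2 + (snd y)\<^sup>2))) * indicator ?H y
       = ennreal (A / 2) * (ennreal (1 / (1 + (norm y)\<^sup>2) ^ (CARD('m) + 1)) * indicator ?H y)"
      by (simp only: mult.assoc)
  qed
  also have "\<dots> = ennreal (A / 2) * ennreal B"
    unfolding B(2)[symmetric] by (rule nn_integral_cmult) measurable
  also have "\<dots> = ennreal (A * B / 2)" using A B by (simp add: ennreal_mult'[symmetric])
  finally show ?thesis .
qed

section \<open>Sharpness of the constant\<close>

lemma best_constant_iff:
  assumes A: "A > 0" "(\<integral>\<^sup>+x. ennreal (1 / (1 + (norm x)\<^sup>2) ^ CARD('m)) \<partial>(lborel :: (real ^ 'm::finite) measure)) = ennreal A"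
    and B: "B > 0" "(\<integral>\<^sup>+y\<in>(half_space :: ((real ^ 'm) \<times> real) set).
        ennreal (1 / (1 + (norm y)\<^sup>2) ^ (CARD('m) + 1)) \<partial>lborel) = ennreal B"
    and p: "p = CARD('m) / (CARD('m) + 1)" and r: "r = (CARD('m) + 1) / (CARD('m) + 2)"
  shows "best_constant TYPE('m) p r C \<longleftrightarrow> C = A powr (- 1 / CARD('m)) * B powr (- 1 / (CARD('m) + 1)) / 2"
proof -
  define C0 where "C0 = A powr (- 1 / CARD('m)) * B powr (- 1 / (CARD('m) + 1)) / 2"
  let ?H = "half_space :: ((real ^ 'm) \<times> real) set"
  have adm: "admissible_constant TYPE('m) p r C0"
    unfolding admissible_constant_def C0_def
  proof (intro allI impI)
    fix f :: "real ^ 'm \<Rightarrow> real" and g :: "(real ^ 'm) \<times> real \<Rightarrow> real"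
    assume "f \<in> Lspace p UNIV" "\<forall>x. 0 \<le> f x" "g \<in> Lspace r half_space" "\<forall>y\<in>half_space. 0 \<le> g y"
    then show "ennreal (A powr (- 1 / CARD('m)) * B powr (- 1 / (CARD('m) + 1)) / 2
            * Lquasinorm p UNIV f * Lquasinorm r half_space g) \<le> interaction f g"
      by (intro interaction_lower_bound[OF A B p r]) (auto simp: Lspace_def lebesgue_on_UNIV_eq)
  qed
  \<comment> \<open>With d = \<open>CARD('m)\<close>, testing on the bubbles of dimensions d and d +
    1 gives C' A^(1+1/d) B^(1+1/(d+1)) <= A B / 2, where C0 gives equality.\<close>
  have max: "C' \<le> C0" if "admissible_constant TYPE('m) p r C'" for C'
  proof -
    have f: "(bubble :: real ^ 'm \<Rightarrow> real) \<in> Lspace p UNIV"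
      "Lquasinorm p UNIV (bubble :: real ^ 'm \<Rightarrow> real) = A powr (1 + 1 / CARD('m))"
      using bubble_Lspace[of "UNIV :: (real ^ 'm) set" A p] A p by auto
    have g: "(bubble :: (real ^ 'm) \<times> real \<Rightarrow> real) \<in> Lspace r half_space"
      "Lquasinorm r half_space (bubble :: (real ^ 'm) \<times> real \<Rightarrow> real) = B powr (1 + 1 / (CARD('m) + 1))"
      using bubble_Lspace[of ?H B r] B r by (auto simp: add.commute)
    have "ennreal (C' * A powr (1 + 1 / CARD('m)) * B powr (1 + 1 / (CARD('m) + 1))) \<le> ennreal (A * B / 2)"
      using that f g bubble_nonneg interaction_bubble[OF A B]
      unfolding admissible_constant_def by metis
    then have "C' * A powr (1 + 1 / CARD('m)) * B powr (1 + 1 / (CARD('m) + 1)) \<le> A * B / 2"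
      using A(1) B(1) by (subst (asm) ennreal_le_iff) auto
    also have "\<dots> = C0 * A powr (1 + 1 / CARD('m)) * B powr (1 + 1 / (CARD('m) + 1))"
    proof -
      have inv: "x powr (- 1 / t) * x powr (1 / t) = 1" if "x > 0" for x t :: real
        using that by (simp add: powr_add[symmetric])
      have "C0 * A powr (1 + 1 / CARD('m)) * B powr (1 + 1 / (CARD('m) + 1))
        = (A powr (- 1 / CARD('m)) * A powr (1 / CARD('m)))
          * (B powr (- 1 / (CARD('m) + 1)) * B powr (1 / (CARD('m) + 1))) * (A * B / 2)"
        using A(1) B(1) by (simp only: powr_add) (simp add: C0_def)
      then show ?thesis unfolding inv[OF A(1)] inv[OF B(1)] by simp
    qed
    finally show ?thesis using A(1) B(1) by simp
  qed
  show ?thesis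
    unfolding best_constant_def C0_def[symmetric] using adm max by (auto intro: antisym)
qed

section \<open>Evaluation of the constant by Gamma functions\<close>

theorem corollary1:
  fixes n :: nat and p r C :: real
  assumes "n \<ge> 2" and "CARD('m::finite) = n - 1"
    and "p = (real n - 1) / real n" and "r = real n / (real n + 1)"
  shows "best_constant TYPE('m) p r C \<longleftrightarrow>
    C = 2 powr (- 1 + 1 / real n) / pi
        * (Gamma (real n) / Gamma (real n / 2)) powr (1 / real n)
        * (Gamma (real n - 1) / Gamma ((real n - 1) / 2)) powr (1 / (real n - 1))"
proof -
  define d where "d = real n - 1"
  \<comment> \<open>A and B are the weight integrals in dimensions n - 1 and n; the factor 1/2 in B
    comes from restricting to the half space.\<close>
  define A where "A = pi powr (d / 2) * (Gamma (d / 2) / Gamma d)"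
  define B where "B = 1 / 2 * pi powr (n / 2) * (Gamma (n / 2) / Gamma n)"
  have d: "d > 0" "real CARD('m) = d" "real n = d + 1" using assms by (auto simp: d_def)
  have G: "Gamma d > 0" "Gamma (d / 2) > 0" "Gamma n > 0" "Gamma (n / 2) > 0"
    using d by (auto intro!: Gamma_real_pos)
  have AB: "A > 0" "B > 0" using G by (simp_all add: A_def B_def)
  have Ai: "(\<integral>\<^sup>+x. ennreal (1 / (1 + (norm x)\<^sup>2) ^ CARD('m)) \<partial>(lborel :: (real ^ 'm) measure)) = ennreal A"
    using nn_integral_conformal_weight[where 'a = "real ^ 'm"] d by (simp add: A_def)
  have "(\<integral>\<^sup>+y. ennreal (1 / (1 + (norm y)\<^sup>2) ^ (CARD('m) + 1)) \<partial>(lborel :: ((real ^ 'm) \<times> real) measure)) = ennreal (2 * B)"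
    using nn_integral_conformal_weight[where 'a = "(real ^ 'm) \<times> real"] d by (simp add: B_def add.commute)
  then have "ennreal 2 * (\<integral>\<^sup>+y\<in>(half_space :: ((real ^ 'm) \<times> real) set).
        ennreal (1 / (1 + (norm y)\<^sup>2) ^ (CARD('m) + 1)) \<partial>lborel) = ennreal 2 * ennreal B"
    using AB by (subst (asm) nn_integral_half_space) (auto simp: ennreal_mult')
  then have Bi: "(\<integral>\<^sup>+y\<in>(half_space :: ((real ^ 'm) \<times> real) set).
        ennreal (1 / (1 + (norm y)\<^sup>2) ^ (CARD('m) + 1)) \<partial>lborel) = ennreal B"
    by (subst (asm) ennreal_mult_cancel_left) auto
  have "best_constant TYPE('m) p r C \<longleftrightarrow> C = A powr (- 1 / d) * B powr (- 1 / n) / 2"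
    using best_constant_iff[OF AB(1) Ai AB(2) Bi, of p r C] assms(3,4) d by (simp add: add.commute)
  \<comment> \<open>The power of pi becomes pi^(-1/2) in either dimension, so A and B together
    contribute 1/pi. The factor 2^(1/n) stems from the half in B, the remaining 1/2 from the
    discriminant bound.\<close>
  also have "A powr (- 1 / d) = pi powr (- 1 / 2) * (Gamma d / Gamma (d / 2)) powr (1 / d)"
    using d(1) G by (simp add: A_def powr_mult powr_powr powr_divide powr_minus field_simps)
  also have "B powr (- 1 / n) = 2 powr (1 / n) * pi powr (- 1 / 2) * (Gamma n / Gamma (n / 2)) powr (1 / n)"
    using assms(1) G by (simp add: B_def powr_mult powr_powr powr_divide powr_minus field_simps)
  also have "pi powr (- 1 / 2) * (Gamma d / Gamma (d / 2)) powr (1 / d) *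
       (2 powr (1 / n) * pi powr (- 1 / 2) * (Gamma n / Gamma (n / 2)) powr (1 / n)) / 2
     = (2 powr (1 / n) * 2 powr (- 1)) * (pi powr (- 1 / 2) * pi powr (- 1 / 2))
        * (Gamma n / Gamma (n / 2)) powr (1 / n) * (Gamma d / Gamma (d / 2)) powr (1 / d)"
    by simp
  also have "pi powr (- 1 / 2) * pi powr (- 1 / 2) = 1 / pi"
    by (simp add: powr_add[symmetric] powr_minus_divide)
  also have "2 powr (1 / n) * 2 powr (- 1 :: real) = 2 powr (- 1 + 1 / n)"
    by (simp only: powr_add[symmetric] add.commute)
  finally show ?thesis by (simp add: d_def)
qed

end
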